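(* For all $n\ge k\ge 1$, the hypergraph program $H_{n,k}$ computes $\textsc{Clique}_{n,k}$.
   Context: $\textsc{Clique}_{n,k}$ is the monotone Boolean function of the $n(n-1)/2$ variables $e_{jj'}$, $1\le j<j'\le n$, returning $1$ iff the graph with vertices $\{1,\dots,n\}$ and edges $\{\{j,j'\}\mid e_{jj'}=1\}$ contains a $k$-clique. A hypergraph program (HGP) is a hypergraph whose vertices are labelled with $0$, $1$, variables or negated variables; it computes $f$ if for every input $\vec{\alpha}$, $f(\vec{\alpha})=1$ iff some set of pairwise disjoint hyperedges contains every vertex whose label evaluates to $0$ under $\vec\alpha$. $H_{n,k}$ is the HGP with vertices: $w_{jj'}$ labelled $e_{jj'}$ ($1\le j<j'\le n$); $u_{jj'}$ and $u_{j'j}$ labelled $1$ ($1\le j<j'\le n$); $v_i$ labelled $0$ ($1\le i\le k$); and hyperedges $h^{jj'}=\{w_{jj'},u_{jj'}\}$ and $h^{j'j}=\{w_{jj'},u_{j'j}\}$ ($1\le j<j'\le n$), and $f^{ij}=\{v_i\}\cup\{u_{jj'}\mid j'\ne j,\ 1\le j'\le n\}$ ($1\le i\le k$, $1\le j\le n$). *)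

theory Defs
  imports "HOL-Library.Ramsey" "HOL-Library.Disjoint_Sets"
begin

datatype 'x label = Zero | One | Pos 'x | Neg 'x

fun label_val :: "('x \<Rightarrow> bool) \<Rightarrow> 'x label \<Rightarrow> bool" where
  "label_val \<alpha> Zero \<longleftrightarrow> False"
| "label_val \<alpha> One \<longleftrightarrow> True"
| "label_val \<alpha> (Pos x) \<longleftrightarrow> \<alpha> x"
| "label_val \<alpha> (Neg x) \<longleftrightarrow> \<not> \<alpha> x"

record ('v, 'x) hgp =
  hverts :: "'v set"
  hedges :: "'v set set"
  hlabel :: "'v \<Rightarrow> 'x label"

definition is_hgp :: "'x set \<Rightarrow> ('v, 'x) hgp \<Rightarrow> bool" where
  "is_hgp X H \<longleftrightarrow> finite (hverts H) \<and> (\<forall>h \<in> hedges H. h \<subseteq> hverts H) \<and>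
     (\<forall>v \<in> hverts H. set_label (hlabel H v) \<subseteq> X)"

text \<open>Inputs are total valuations of the type of variables; values outside the variables
  of the program are irrelevant.\<close>

definition hgp_computes :: "('v, 'x) hgp \<Rightarrow> (('x \<Rightarrow> bool) \<Rightarrow> bool) \<Rightarrow> bool" where
  "hgp_computes H f \<longleftrightarrow>
     (\<forall>\<alpha>. f \<alpha> \<longleftrightarrow>
        (\<exists>F \<subseteq> hedges H. disjoint F \<and>
           {v \<in> hverts H. \<not> label_val \<alpha> (hlabel H v)} \<subseteq> \<Union>F))"

text \<open>The pair \<open>(j, j')\<close> with \<open>j < j'\<close> stands for the variable \<open>e\<^bsub>jj'\<^esub>\<close>.\<close>

definition edge_vars :: "nat \<Rightarrow> (nat \<times> nat) set" where
  "edge_vars n = {(j, j'). 1 \<le> j \<and> j < j' \<and> j' \<le> n}"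

definition input_edges :: "nat \<Rightarrow> (nat \<times> nat \<Rightarrow> bool) \<Rightarrow> nat set set" where
  "input_edges n e = {{j, j'} | j j'. (j, j') \<in> edge_vars n \<and> e (j, j')}"

definition Clique :: "nat \<Rightarrow> nat \<Rightarrow> (nat \<times> nat \<Rightarrow> bool) \<Rightarrow> bool" where
  "Clique n k e \<longleftrightarrow> (\<exists>C \<subseteq> {1..n}. card C = k \<and> clique C (input_edges n e))"

datatype clique_vertex = W nat nat | U nat nat | V nat

fun clique_label :: "clique_vertex \<Rightarrow> (nat \<times> nat) label" where
  "clique_label (W j j') = Pos (j, j')"
| "clique_label (U j j') = One"
| "clique_label (V i) = Zero"

definition H_clique :: "nat \<Rightarrow> nat \<Rightarrow> (clique_vertex, nat \<times> nat) hgp" where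
  "H_clique n k =
    \<lparr> hverts =
        {W j j' | j j'. 1 \<le> j \<and> j < j' \<and> j' \<le> n} \<union>
        {U j j' | j j'. 1 \<le> j \<and> j < j' \<and> j' \<le> n} \<union>
        {U j' j | j j'. 1 \<le> j \<and> j < j' \<and> j' \<le> n} \<union>
        {V i | i. 1 \<le> i \<and> i \<le> k},
      hedges =
        {{W j j', U j j'} | j j'. 1 \<le> j \<and> j < j' \<and> j' \<le> n} \<union>
        {{W j j', U j' j} | j j'. 1 \<le> j \<and> j < j' \<and> j' \<le> n} \<union>
        {{V i} \<union> {U j j' | j'. j' \<noteq> j \<and> 1 \<le> j' \<and> j' \<le> n} | i j.
           1 \<le> i \<and> i \<le> k \<and> 1 \<le> j \<and> j \<le> n},
      hlabel = clique_label \<rparr>"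

lemma is_hgp_H_clique: "is_hgp (edge_vars n) (H_clique n k)"
proof -
  have "hverts (H_clique n k) \<subseteq>
      (\<lambda>(j, j'). W j j') ` ({1..n} \<times> {1..n}) \<union> (\<lambda>(j, j'). U j j') ` ({1..n} \<times> {1..n}) \<union> V ` {1..k}"
    by (force simp: H_clique_def)
  then have "finite (hverts (H_clique n k))"
    by (rule finite_subset) auto
  then show ?thesis
    by (auto simp: is_hgp_def H_clique_def edge_vars_def)
qed

lemma Clique_cong:
  assumes "\<And>x. x \<in> edge_vars n \<Longrightarrow> e x = e' x"
  shows "Clique n k e = Clique n k e'"
proof -
  have "input_edges n e = input_edges n e'"
    using assms unfolding input_edges_def by blast
  then show ?thesis by (simp add: Clique_def)
qed

end

theory Submission
  imports Defs
begin

text \<open>A hyperedge \<open>f\<^bsup>ij\<^esup>\<close> of a cover selects \<open>j\<close> as the \<open>i\<close>-th vertex of the clique. It uses up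
  all the \<open>u\<^bsub>jj'\<^esub>\<close>, so an absent edge \<open>jj'\<close>, whose \<open>w\<^bsub>jj'\<^esub>\<close> has to be covered together with
  \<open>u\<^bsub>jj'\<^esub>\<close> or \<open>u\<^bsub>j'j\<^esub>\<close>, can have at most one of its ends selected.\<close>

definition clique_star :: "nat \<Rightarrow> nat \<Rightarrow> nat \<Rightarrow> clique_vertex set" where
  "clique_star n i j = {V i} \<union> {U j j' | j'. j' \<noteq> j \<and> 1 \<le> j' \<and> j' \<le> n}"

lemma V_in_clique_star [simp]: "V i' \<in> clique_star n i j \<longleftrightarrow> i' = i"
  and U_in_clique_star [simp]:
    "U a b \<in> clique_star n i j \<longleftrightarrow> a = j \<and> b \<noteq> j \<and> 1 \<le> b \<and> b \<le> n"
  and W_in_clique_star [simp]: "W a b \<notin> clique_star n i j"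
  by (auto simp: clique_star_def)

lemma hedges_H_clique:
  "hedges (H_clique n k) =
     {{W j j', U j j'} | j j'. 1 \<le> j \<and> j < j' \<and> j' \<le> n} \<union>
     {{W j j', U j' j} | j j'. 1 \<le> j \<and> j < j' \<and> j' \<le> n} \<union>
     {clique_star n i j | i j. 1 \<le> i \<and> i \<le> k \<and> 1 \<le> j \<and> j \<le> n}"
  by (simp add: H_clique_def clique_star_def)

lemma false_hverts_H_clique:
  "{v \<in> hverts (H_clique n k). \<not> label_val e (hlabel (H_clique n k) v)} =
     {W j j' | j j'. 1 \<le> j \<and> j < j' \<and> j' \<le> n \<and> \<not> e (j, j')} \<union> V ` {1..k}"
  by (auto simp: H_clique_def)

text \<open>The assumed order rules out the swapped reading of the unordered pair, so a single
  variable decides membership.\<close>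

lemma doubleton_in_input_edges:
  assumes "j < j'"
  shows "{j, j'} \<in> input_edges n e \<longleftrightarrow> 1 \<le> j \<and> j' \<le> n \<and> e (j, j')"
  using assms by (fastforce simp: input_edges_def edge_vars_def doubleton_eq_iff)

text \<open>By symmetry of doubletons it suffices to test increasing pairs;
  \<open>C \<subseteq> {1..n}\<close> supplies the range bounds.\<close>

lemma clique_input_edges_iff:
  assumes "C \<subseteq> {1..n}"
  shows "clique C (input_edges n e) \<longleftrightarrow> (\<forall>j\<in>C. \<forall>j'\<in>C. j < j' \<longrightarrow> e (j, j'))"
proof
  assume "clique C (input_edges n e)"
  then show "\<forall>j\<in>C. \<forall>j'\<in>C. j < j' \<longrightarrow> e (j, j')"
    unfolding clique_def by (metis doubleton_in_input_edges less_irrefl)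
next
  assume *: "\<forall>j\<in>C. \<forall>j'\<in>C. j < j' \<longrightarrow> e (j, j')"
  have "{j, j'} \<in> input_edges n e" if "j \<in> C" "j' \<in> C" "j < j'" for j j'
    using that * assms by (auto simp: doubleton_in_input_edges)
  then show "clique C (input_edges n e)"
    unfolding clique_def by (metis insert_commute linorder_neqE_nat)
qed

text \<open>With the clique enumerated as \<open>g\<close>, the stars of \<open>i\<close> and
  \<open>g i\<close> cover all \<open>V i\<close> and occupy only \<open>U\<close> vertices whose
  first index lies in \<open>C\<close>. An absent edge has an end outside \<open>C\<close>, and the
  \<open>U\<close> vertex starting at that end is free to cover its \<open>W\<close>.\<close>

lemma cover_if_Clique:
  assumes "Clique n k e"
  shows "\<exists>F \<subseteq> hedges (H_clique n k). disjoint F \<and>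
    {v \<in> hverts (H_clique n k). \<not> label_val e (hlabel (H_clique n k) v)} \<subseteq> \<Union>F"
proof -
  obtain C where C: "C \<subseteq> {1..n}" "card C = k"
    and e: "\<And>j j'. j \<in> C \<Longrightarrow> j' \<in> C \<Longrightarrow> j < j' \<Longrightarrow> e (j, j')"
    using assms unfolding Clique_def by (metis clique_input_edges_iff)
  have "finite C"
    using C(1) by (rule finite_subset) simp
  then obtain g where g: "bij_betw g {1..k} C"
    using C(2) by (metis card_atLeastAtMost diff_Suc_1 finite_atLeastAtMost finite_same_card_bij)
  have gC: "g i \<in> C" if "i \<in> {1..k}" for i
    using g that by (auto simp: bij_betw_def)
  have ginj: "i = i'" if "i \<in> {1..k}" "i' \<in> {1..k}" "g i = g i'" for i i'
    using g that unfolding bij_betw_def inj_on_def by blast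
  \<comment> \<open>The pair of an absent edge is taken at the smaller end unless that end is in
    \<open>C\<close>, and at the larger end otherwise. Exactly one case applies, so no
    \<open>W\<close> is used twice.\<close>
  define A where "A = {{W j j', U j j'} | j j'. 1 \<le> j \<and> j < j' \<and> j' \<le> n \<and> \<not> e (j, j') \<and> j \<notin> C}"
  define B where "B = {{W j j', U j' j} | j j'. 1 \<le> j \<and> j < j' \<and> j' \<le> n \<and> \<not> e (j, j') \<and> j \<in> C}"
  define S where "S = (\<lambda>i. clique_star n i (g i)) ` {1..k}"
  have "A \<union> B \<union> S \<subseteq> hedges (H_clique n k)"
  proof -
    have "A \<union> B \<subseteq> hedges (H_clique n k)"
      unfolding A_def B_def hedges_H_clique by blast
    moreover have "clique_star n i (g i) \<in> hedges (H_clique n k)" if "i \<in> {1..k}" for i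
    proof -
      have "1 \<le> i \<and> i \<le> k" "1 \<le> g i \<and> g i \<le> n"
        using that gC[OF that] C(1) by auto
      then show ?thesis
        unfolding hedges_H_clique by blast
    qed
    ultimately show ?thesis
      unfolding S_def by blast
  qed
  moreover have "disjoint (A \<union> B \<union> S)"
  proof -
    have AA: "a \<inter> b = {}" if "a \<in> A \<union> B" "b \<in> A \<union> B" "a \<noteq> b" for a b
      using that unfolding A_def B_def by auto
    have AS: "a \<inter> b = {}" if ab: "a \<in> A \<union> B" "b \<in> S" for a b
    proof -
      obtain i where i: "i \<in> {1..k}" "b = clique_star n i (g i)"
        using ab(2) unfolding S_def by blast
      have "\<exists>x y z w. a = {W x y, U z w} \<and> z \<notin> C"
        using ab(1)
      proof
        assume "a \<in> A"
        then show ?thesis unfolding A_def by blast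
      next
        assume "a \<in> B"
        \<comment> \<open>Here \<open>j \<in> C\<close>; if \<open>j'\<close> were in
          \<open>C\<close> too, the edge would be present.\<close>
        then show ?thesis unfolding B_def using e by blast
      qed
      then obtain x y z w where "a = {W x y, U z w}" "z \<notin> C"
        by blast
      then show ?thesis
        using i gC[OF i(1)] by auto
    qed
    have SS: "a \<inter> b = {}" if ab: "a \<in> S" "b \<in> S" "a \<noteq> b" for a b
    proof -
      obtain i i' where i: "i \<in> {1..k}" "a = clique_star n i (g i)"
          "i' \<in> {1..k}" "b = clique_star n i' (g i')"
        using ab unfolding S_def by blast
      \<comment> \<open>The first inequality separates the \<open>V\<close> vertices of the two
        stars, the second their \<open>U\<close> vertices.\<close>
      then have "i \<noteq> i'" "g i \<noteq> g i'"
        using ab(3) ginj by blast+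
      then show ?thesis
        unfolding i by (auto simp: clique_star_def)
    qed
    show ?thesis
      using AA AS SS unfolding disjoint_def by (blast dest: AS)
  qed
  moreover have "W j j' \<in> \<Union>(A \<union> B)" if "1 \<le> j" "j < j'" "j' \<le> n" "\<not> e (j, j')" for j j'
    using that unfolding A_def B_def by (cases "j \<in> C") blast+
  moreover have "V i \<in> \<Union>S" if "i \<in> {1..k}" for i
    using that unfolding S_def by auto
  ultimately show ?thesis
    unfolding false_hverts_H_clique by (intro exI[of _ "A \<union> B \<union> S"]) blast
qed

text \<open>Only stars contain \<open>V\<close> vertices, so the cover yields a choice
  \<open>g\<close> of centres. Disjointness makes \<open>g\<close> injective and leaves no room to
  cover the \<open>W\<close> of an absent edge between two chosen centres.\<close>

lemma Clique_if_cover: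
  assumes "k \<le> n" and F: "F \<subseteq> hedges (H_clique n k)" and disj: "disjoint F"
    and cover: "{v \<in> hverts (H_clique n k). \<not> label_val e (hlabel (H_clique n k) v)} \<subseteq> \<Union>F"
  shows "Clique n k e"
proof -
  have meet: "h = h'" if "h \<in> F" "h' \<in> F" "x \<in> h" "x \<in> h'" for h h' x
    using disj that unfolding disjoint_def by blast
  have "\<exists>j. j \<in> {1..n} \<and> clique_star n i j \<in> F" if i: "i \<in> {1..k}" for i
  proof -
    obtain h where h: "h \<in> F" "V i \<in> h"
      using cover i unfolding false_hverts_H_clique by blast
    moreover from h F have "h \<in> hedges (H_clique n k)"
      by blast
    ultimately show ?thesis
      unfolding hedges_H_clique by auto
  qed
  then obtain g where g: "\<And>i. i \<in> {1..k} \<Longrightarrow> g i \<in> {1..n}"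
      "\<And>i. i \<in> {1..k} \<Longrightarrow> clique_star n i (g i) \<in> F"
    by metis
  have "inj_on g {1..k}"
  proof (rule inj_onI, rule ccontr)
    fix i i' assume i: "i \<in> {1..k}" "i' \<in> {1..k}" "g i = g i'" "i \<noteq> i'"
    \<comment> \<open>Any vertex of \<open>{1..n}\<close> other than \<open>g i\<close> would do.
      One exists because \<open>i \<noteq> i'\<close> forces \<open>2 \<le> k\<close>, hence
      \<open>2 \<le> n\<close>; for \<open>n = 1\<close> stars contain no \<open>U\<close> vertex
      and could share a centre.\<close>
    define b where "b = (if g i = 1 then 2 else 1 :: nat)"
    have "U (g i) b \<in> clique_star n i (g i)" "U (g i) b \<in> clique_star n i' (g i')"
      using i \<open>k \<le> n\<close> by (auto simp: b_def)
    then have "clique_star n i (g i) = clique_star n i' (g i')"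
      using meet g(2) i by blast
    then show False
      using i by (metis V_in_clique_star)
  qed
  then have "card (g ` {1..k}) = k"
    by (simp add: card_image)
  moreover have sub: "g ` {1..k} \<subseteq> {1..n}"
    using g(1) by blast
  moreover have "e (g a, g b)" if ab: "a \<in> {1..k}" "b \<in> {1..k}" "g a < g b" for a b
  proof (rule ccontr)
    assume "\<not> e (g a, g b)"
    then have "W (g a) (g b) \<in> \<Union>F"
      using cover ab(3) g(1)[OF ab(1)] g(1)[OF ab(2)]
      unfolding false_hverts_H_clique atLeastAtMost_iff by blast
    then obtain h where h: "h \<in> F" "W (g a) (g b) \<in> h"
      by blast
    moreover from h F have "h \<in> hedges (H_clique n k)"
      by blast
    \<comment> \<open>Both possible partners of this \<open>W\<close> are already taken by the stars
      centred at \<open>g a\<close> and \<open>g b\<close>, so \<open>h\<close> would have to be one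
      of these stars, but a star contains no \<open>W\<close>.\<close>
    ultimately have "U (g a) (g b) \<in> h \<or> U (g b) (g a) \<in> h"
      unfolding hedges_H_clique by auto
    moreover have "U (g a) (g b) \<in> clique_star n a (g a)" "U (g b) (g a) \<in> clique_star n b (g b)"
      using ab g(1)[OF ab(1)] g(1)[OF ab(2)] by auto
    ultimately have "h = clique_star n a (g a) \<or> h = clique_star n b (g b)"
      using meet h(1) g(2) ab by blast
    then show False
      using h(2) by auto
  qed
  then have "clique (g ` {1..k}) (input_edges n e)"
    unfolding clique_input_edges_iff[OF sub] by blast
  ultimately show ?thesis
    unfolding Clique_def by blast
qed

theorem theorem14:
  fixes n k :: nat
  assumes "1 \<le> k" and "k \<le> n"
  shows "hgp_computes (H_clique n k) (Clique n k)"
  unfolding hgp_computes_def using cover_if_Clique Clique_if_cover[OF assms(2)] by blast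

end
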